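(* Let $t>3$ be an odd integer. Then $\chi_2(G_t)=5$ if $t\equiv 1$ or $9 \pmod{10}$, and $\chi_2(G_t)=6$ if $t\equiv 3,5$ or $7\pmod{10}$. Moreover, $\chi_2(G_3)=7$.
   Context: For an odd integer $t\ge 3$, $G_t$ denotes the integer distance graph $G(\mathbb{Z},\{2,t\})$: its vertex set is $\mathbb{Z}$, and distinct $i,j\in\mathbb{Z}$ are adjacent if and only if $|i-j|\in\{2,t\}$. For a graph $G$, a $2$-distance $k$-coloring is a map $f:V(G)\to\{1,\ldots,k\}$ such that any two distinct vertices $u,v$ with $f(u)=f(v)$ satisfy $d_G(u,v)>2$ ($d_G$ the shortest-path distance); $\chi_2(G)$ is the smallest such $k$. *)

theory Defs
  imports Main "HOL-Library.Extended_Nat" "HOL-Number_Theory.Cong"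
begin

record 'a graph =
  verts :: "'a set"
  edges :: "('a \<times> 'a) set"

text \<open>Undirected edges are represented by a symmetric relation; \<open>(u, v) \<in> edges G ^^ n\<close> says that
  there is a walk of length \<open>n\<close> from \<open>u\<close> to \<open>v\<close>.  The distance is \<open>\<infinity>\<close> if there is none.\<close>

definition graph_dist :: "'a graph \<Rightarrow> 'a \<Rightarrow> 'a \<Rightarrow> enat" where
  "graph_dist G u v = Inf {enat n | n. (u, v) \<in> edges G ^^ n}"

definition two_distance_coloring :: "'a graph \<Rightarrow> nat \<Rightarrow> ('a \<Rightarrow> nat) \<Rightarrow> bool" where
  "two_distance_coloring G k f \<longleftrightarrow>
     (\<forall>v \<in> verts G. f v \<in> {1..k}) \<and>
     (\<forall>u \<in> verts G. \<forall>v \<in> verts G. u \<noteq> v \<and> f u = f v \<longrightarrow> graph_dist G u v > 2)"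

text \<open>The value is \<open>\<infinity>\<close> if no finite number of colors suffices.\<close>

definition chi2 :: "'a graph \<Rightarrow> enat" where
  "chi2 G = Inf {enat k | k. \<exists>f. two_distance_coloring G k f}"

definition distance_graph :: "int set \<Rightarrow> int graph" where
  "distance_graph D = \<lparr>verts = UNIV, edges = {(i, j). i \<noteq> j \<and> \<bar>i - j\<bar> \<in> D}\<rparr>"

definition Gt :: "int \<Rightarrow> int graph" where
  "Gt t = distance_graph {2, t}"

end

theory Submission
  imports Defs
begin

text \<open>
  Distinct vertices of \<open>Gt t\<close> are at distance at most 2 iff they differ by
  \<open>2, 4, t - 2, t, t + 2\<close> or \<open>2t\<close>.  Via \<open>(i, j) \<mapsto> 2i + tj\<close> the graph is a quotient of the square
  grid, so each color class of a 5-coloring is a perfect code: every closed neighborhood meets it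
  exactly once.  Near a codeword \<open>y\<close> this forces all four codewords
  \<open>y \<plusminus> (2a + b), y \<plusminus> (a - 2b)\<close> with \<open>(a, b) = (2, t)\<close> or all four with \<open>(a, b) = (t, 2)\<close>,
  hence the whole lattice coset they generate.  For \<open>t \<equiv> 3, 5, 7 (mod 10)\<close> that coset is all of
  the integers, which is absurd; for \<open>t \<equiv> 1, 9\<close> reduction modulo 5 is a coloring.

  With six colors, reduction modulo 6 works unless \<open>3\<close> divides \<open>t\<close>.  In that case modulo \<open>t + 1\<close>
  the forbidden differences become \<open>1, 2, 3, 4\<close>, and \<open>t + 1 \<equiv> 4 (mod 6)\<close> permits the periodic
  word \<open>12345 12345 123456 \<dots> 123456\<close>.
\<close>

section \<open>Distance at most 2 in terms of differences\<close>

lemma graph_dist_gt_2_iff: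
  "graph_dist G u v > 2 \<longleftrightarrow> u \<noteq> v \<and> (u, v) \<notin> edges G \<and> (u, v) \<notin> edges G O edges G"
proof -
  \<comment> \<open>Written with \<open>3 \<le>\<close>, the bound passes through the infimum that
    defines the distance.\<close>
  have "graph_dist G u v > 2 \<longleftrightarrow> 3 \<le> graph_dist G u v"
    by (cases "graph_dist G u v") (auto simp: numeral_eq_enat)
  also have "\<dots> \<longleftrightarrow> (\<forall>n. (u, v) \<in> edges G ^^ n \<longrightarrow> 3 \<le> n)"
    by (auto simp: graph_dist_def le_Inf_iff numeral_eq_enat)
  also have "\<dots> \<longleftrightarrow> (\<forall>n\<in>{0, 1, 2}. (u, v) \<notin> edges G ^^ n)"
  proof -
    have "\<not> 3 \<le> n \<longleftrightarrow> n \<in> {0, 1, 2}" for n :: nat by auto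
    then show ?thesis by blast
  qed
  also have "\<dots> \<longleftrightarrow> u \<noteq> v \<and> (u, v) \<notin> edges G \<and> (u, v) \<notin> edges G O edges G"
    by (simp add: numeral_2_eq_2)
  finally show ?thesis .
qed

lemma Gt_dist_gt_2_iff:
  assumes "t > 2"
  shows "graph_dist (Gt t) u v > 2 \<longleftrightarrow>
    u \<noteq> v \<and> \<bar>u - v\<bar> \<notin> {2, 4, t - 2, t, t + 2, 2 * t}"
proof -
  have "(u, v) \<in> edges (Gt t) O edges (Gt t) \<longleftrightarrow> \<bar>u - v\<bar> \<in> {0, 4, t - 2, t + 2, 2 * t}"
  proof
    assume "(u, v) \<in> edges (Gt t) O edges (Gt t)"
    then obtain w where "\<bar>u - w\<bar> = 2 \<or> \<bar>u - w\<bar> = t" "\<bar>w - v\<bar> = 2 \<or> \<bar>w - v\<bar> = t"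
      by (auto simp: Gt_def distance_graph_def)
    then have "\<bar>u - v\<bar> = 0 \<or> \<bar>u - v\<bar> = 4 \<or> \<bar>u - v\<bar> = t - 2 \<or> \<bar>u - v\<bar> = t + 2 \<or> \<bar>u - v\<bar> = 2 * t"
      using assms by (smt (verit))
    then show "\<bar>u - v\<bar> \<in> {0, 4, t - 2, t + 2, 2 * t}" by simp
  next
    assume "\<bar>u - v\<bar> \<in> {0, 4, t - 2, t + 2, 2 * t}"
    \<comment> \<open>Each value is spelled as a sum of two signed steps, so that a midpoint
      \<open>u + d\<close> can be read off.\<close>
    then have "v - u \<in> {2 + -2, 2 + 2, -2 + -2, t + -2, -t + 2, t + 2, -t + -2, t + t, -t + -t}"
      by auto
    then obtain d e where "d \<in> {2, -2, t, -t}" "e \<in> {2, -2, t, -t}" "v - u = d + e"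
      by (elim insertE emptyE) blast+
    then have "d \<in> {2, -2, t, -t}" "e \<in> {2, -2, t, -t}" "v = u + d + e" by auto
    then have "(u, u + d) \<in> edges (Gt t)" "(u + d, v) \<in> edges (Gt t)"
      using assms by (auto simp: Gt_def distance_graph_def)
    then show "(u, v) \<in> edges (Gt t) O edges (Gt t)" by auto
  qed
  moreover have "(u, v) \<in> edges (Gt t) \<longleftrightarrow> \<bar>u - v\<bar> \<in> {2, t}"
    using assms by (auto simp: Gt_def distance_graph_def)
  ultimately show ?thesis
    using assms by (auto simp: graph_dist_gt_2_iff)
qed

lemma two_distance_coloring_Gt_iff:
  assumes "t > 2"
  shows "two_distance_coloring (Gt t) k f \<longleftrightarrow>
    (\<forall>v. f v \<in> {1..k}) \<and> (\<forall>d\<in>{2, 4, t - 2, t, t + 2, 2 * t}. \<forall>v. f (v + d) \<noteq> f v)"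
proof -
  let ?D = "{2, 4, t - 2, t, t + 2, 2 * t}"
  have "(\<forall>u v. u \<noteq> v \<and> f u = f v \<longrightarrow> \<bar>u - v\<bar> \<notin> ?D) \<longleftrightarrow> (\<forall>d\<in>?D. \<forall>v. f (v + d) \<noteq> f v)"
    (is "?L \<longleftrightarrow> ?R")
  proof
    assume L: ?L
    show ?R
    proof (intro ballI allI)
      fix d v assume d: "d \<in> ?D"
      then have "d > 0" using assms by auto
      then show "f (v + d) \<noteq> f v" using L[rule_format, of "v + d" v] d by auto
    qed
  next
    assume R: ?R
    show ?L
    proof (intro allI impI notI)
      fix u v assume *: "u \<noteq> v \<and> f u = f v" "\<bar>u - v\<bar> \<in> ?D"
      have "f (min u v + \<bar>u - v\<bar>) \<noteq> f (min u v)" using R *(2) by blast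
      moreover have "min u v + \<bar>u - v\<bar> = max u v" by (simp add: min_def max_def)
      ultimately show False using *(1) by (simp add: min_def max_def split: if_splits)
    qed
  qed
  moreover have "verts (Gt t) = UNIV" by (simp add: Gt_def distance_graph_def)
  ultimately show ?thesis
    using assms by (simp add: two_distance_coloring_def Gt_dist_gt_2_iff)
qed

lemma two_distance_coloring_Gt_neq:
  assumes "two_distance_coloring (Gt t) k f" "t > 2"
    and "\<bar>x - y\<bar> \<in> {2, 4, t - 2, t, t + 2, 2 * t}"
  shows "f x \<noteq> f y"
proof -
  have "x \<noteq> y" "\<not> graph_dist (Gt t) x y > 2"
    using assms(2,3) by (auto simp: Gt_dist_gt_2_iff)
  then show ?thesis
    using assms(1) by (auto simp: two_distance_coloring_def Gt_def distance_graph_def)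
qed

lemma chi2_eqI:
  assumes "two_distance_coloring G k f"
    and "\<And>j g. two_distance_coloring G j g \<Longrightarrow> k \<le> j"
  shows "chi2 G = enat k"
  unfolding chi2_def
proof (rule antisym)
  show "Inf {enat k | k. \<exists>f. two_distance_coloring G k f} \<le> enat k"
    using assms(1) by (intro Inf_lower) blast
  show "enat k \<le> Inf {enat k | k. \<exists>f. two_distance_coloring G k f}"
    using assms(2) by (intro Inf_greatest) auto
qed

section \<open>Closed neighborhoods and the bound of five colors\<close>

text \<open>Any two of the five points are adjacent or have \<open>z\<close> as a common
  neighbor.\<close>

lemma inj_on_closed_neighborhood:
  assumes "t > 3" "two_distance_coloring (Gt t) k f"
  shows "inj_on f {z, z + 2, z - 2, z + t, z - t}"
proof -
  have "\<bar>x - y\<bar> \<in> {2, 4, t - 2, t, t + 2, 2 * t}"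
    if "x \<in> {z, z + 2, z - 2, z + t, z - t}" "y \<in> {z, z + 2, z - 2, z + t, z - t}" "x \<noteq> y" for x y
    using that assms(1) by (elim insertE emptyE) auto
  then show ?thesis
    using two_distance_coloring_Gt_neq[OF assms(2)] assms(1) by (intro inj_onI) force
qed

lemma five_le_if_coloring:
  assumes "t > 3" "two_distance_coloring (Gt t) k f"
  shows "5 \<le> k"
proof -
  have "card {0, 0 + 2, 0 - 2, 0 + t, 0 - t} \<le> card {1..k}"
    using inj_on_closed_neighborhood[OF assms, of 0]
  proof (rule card_inj_on_le)
    show "f ` {0, 0 + 2, 0 - 2, 0 + t, 0 - t} \<subseteq> {1..k}"
      using assms by (auto simp: two_distance_coloring_Gt_iff)
  qed simp
  then show ?thesis using assms(1) by (simp add: card_insert_if)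
qed

section \<open>Perfect codes of the square grid, projected to the integers\<close>

text \<open>By \<open>cover\<close> a closed neighborhood meets \<open>C\<close> at least once, by
  \<open>packing\<close> at most once. The steps may be negative, so that turns and reflections of
  the grid give instances again.\<close>

locale grid_code =
  fixes a b :: int and C :: "int set"
  assumes cover: "\<exists>d\<in>{0, a, -a, b, -b}. z + d \<in> C"
    and packing: "y \<in> C \<Longrightarrow> d \<in> {a, b, 2 * a, 2 * b, a + b, a - b} \<Longrightarrow> y + d \<notin> C"
begin

lemma packing_neg:
  assumes "y \<in> C" "d \<in> {a, b, 2 * a, 2 * b, a + b, a - b}"
  shows "y - d \<notin> C"
  using packing[of "y - d" d] assms by auto

lemma rotate: "grid_code (-b) a C"
proof
  show "\<exists>d\<in>{0, -b, -(-b), a, -a}. z + d \<in> C" for z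
    using cover[of z] by auto
  show "y + d \<notin> C" if "y \<in> C" "d \<in> {-b, a, 2 * (-b), 2 * a, -b + a, -b - a}" for y d
    using packing[OF that(1), of d] packing_neg[OF that(1), of "-d"] that(2) by auto
qed

lemma swap: "grid_code b a C"
proof
  show "\<exists>d\<in>{0, b, -b, a, -a}. z + d \<in> C" for z
    using cover[of z] by auto
  show "y + d \<notin> C" if "y \<in> C" "d \<in> {b, a, 2 * b, 2 * a, b + a, b - a}" for y d
    using packing[OF that(1), of d] packing_neg[OF that(1), of "-d"] that(2) by auto
qed

text \<open>The neighborhood of \<open>y + (a + b)\<close> contains a codeword; three of its five
  points are too close to \<open>y\<close>, which leaves the two knight moves.\<close>

lemma knight_exists:
  assumes "y \<in> C"
  shows "y + (2 * a + b) \<in> C \<or> y + (2 * b + a) \<in> C"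
  using cover[of "y + (a + b)"] packing[OF assms, of a] packing[OF assms, of b]
    packing[OF assms, of "a + b"]
  by (auto simp: algebra_simps)

text \<open>In the neighborhood of \<open>y + (a - b)\<close>, three points are too close to
  \<open>y\<close>, and \<open>y + (2 * a - b)\<close> is too close to the codeword
  \<open>y + (2 * a + b)\<close>.\<close>

lemma knight_turn:
  assumes "y \<in> C" "y + (2 * a + b) \<in> C"
  shows "y + (a - 2 * b) \<in> C"
  using cover[of "y + (a - b)"] packing[OF assms(1), of a] packing_neg[OF assms(1), of b]
    packing[OF assms(1), of "a - b"] packing_neg[OF assms(2), of "2 * b"]
  by (auto simp: algebra_simps)

end

text \<open>The order of the steps fixes the handedness of the move: \<open>knight b a\<close> is
  the mirror image, while quarter turns preserve it.\<close>

definition knight :: "int \<Rightarrow> int \<Rightarrow> int set \<Rightarrow> int \<Rightarrow> bool" where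
  "knight a b C y \<longleftrightarrow> y \<in> C \<and> y + (2 * a + b) \<in> C"

lemma knight_rotate:
  assumes "grid_code a b C" "knight a b C y"
  shows "knight (-b) a C y"
  using grid_code.knight_turn[OF assms(1), of y] assms(2) by (simp add: knight_def)

text \<open>Four quarter turns are the identity, so the one-way implications close up into an
  equivalence.\<close>

lemma knight_rotate2:
  assumes "grid_code a b C"
  shows "knight (-a) (-b) C y \<longleftrightarrow> knight a b C y"
  using knight_rotate[OF assms, of y] knight_rotate[OF grid_code.rotate[OF assms], of y]
    knight_rotate[OF grid_code.rotate[OF grid_code.rotate[OF assms]], of y]
    knight_rotate[OF grid_code.rotate[OF grid_code.rotate[OF grid_code.rotate[OF assms]]], of y]
  by auto

lemma knight_step:
  assumes "grid_code a b C" "knight a b C y"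
  shows "knight a b C (y + (2 * a + b))" "knight a b C (y - (2 * a + b))"
proof -
  \<comment> \<open>Seen from its far end, the same pair of codewords is the half-turned
    move.\<close>
  have "knight (-a) (-b) C (y + (2 * a + b))"
    using assms(2) by (auto simp: knight_def)
  then show "knight a b C (y + (2 * a + b))"
    by (simp add: knight_rotate2[OF assms(1)])
  have "knight (-a) (-b) C y"
    using assms by (simp add: knight_rotate2)
  then show "knight a b C (y - (2 * a + b))"
    by (simp add: knight_def algebra_simps)
qed

lemma int_multiple_closed:
  fixes d k y :: int
  assumes "P y" and "\<And>y. P y \<Longrightarrow> P (y + d)" and "\<And>y. P y \<Longrightarrow> P (y - d)"
  shows "P (y + k * d)"
proof (induction k rule: int_induct[where k = 0])
  case base
  then show ?case using assms(1) by simp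
next
  case (step1 i)
  then show ?case using assms(2)[of "y + i * d"] by (simp add: algebra_simps)
next
  case (step2 i)
  then show ?case using assms(3)[of "y + i * d"] by (simp add: algebra_simps)
qed

text \<open>Travel first along \<open>2 * a + b\<close>; a quarter turn then makes
  \<open>a - 2 * b\<close> the direction of travel.\<close>

lemma knight_lattice:
  assumes code: "grid_code a b C" and "knight a b C y"
  shows "y + m * (2 * a + b) + n * (a - 2 * b) \<in> C"
proof -
  have 1: "knight a b C (y + m * (2 * a + b))"
    using assms(2) knight_step[OF code] by (rule int_multiple_closed)
  have "knight (-b) a C (y + m * (2 * a + b) + n * (2 * (-b) + a))"
    using knight_rotate[OF code 1] knight_step[OF grid_code.rotate[OF code]]
    by (rule int_multiple_closed)
  then show ?thesis by (simp add: knight_def)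
qed

section \<open>Residues 3, 5, 7: six colors are needed\<close>

text \<open>The gcd of the two lattice generators is that of 10 with \<open>t + 4\<close> or with
  \<open>t - 4\<close>, depending on the handedness; for these residues it is 1, so
  \<open>y + 2\<close> would be a codeword.\<close>

lemma no_grid_code:
  fixes t :: int
  assumes "t mod 10 \<in> {3, 5, 7}"
  shows "\<not> grid_code 2 t C"
proof
  assume code: "grid_code 2 t C"
  interpret grid_code 2 t C by (fact code)
  define k where "k = t div 10"
  have t: "t = 10 * k + 3 \<or> t = 10 * k + 5 \<or> t = 10 * k + 7"
    using assms unfolding k_def insert_iff empty_iff by presburger
  obtain y where y: "y \<in> C" using cover by blast
  then consider "knight 2 t C y" | "knight t 2 C y"
    using knight_exists[OF y] by (auto simp: knight_def)
  \<comment> \<open>The multipliers below are Bezout coefficients expressing 2, one pair per residue of \<open>t\<close>.\<close>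
  then have "y + 2 \<in> C"
  proof cases
    case 1
    have lat: "y + m * (t + 4) + n * (2 - 2 * t) \<in> C" for m n
      using knight_lattice[OF code 1, of m n] by (simp add: algebra_simps)
    show ?thesis
      using t lat[of "6 - 2 * (6 * k + 4)" "-(6 * k + 4)"]
        lat[of "4 * k + 2" "2 * k + 2"] lat[of "- 4 * k - 2" "- 2 * k - 2"]
      by (auto simp: algebra_simps)
  next
    case 2
    have lat: "y + m * (2 * t + 2) + n * (t - 4) \<in> C" for m n
      using knight_lattice[OF swap 2, of m n] by (simp add: algebra_simps)
    show ?thesis
      using t lat[of "2 * k" "- 4 * k - 2"] lat[of "- 2 * k" "2 + 4 * k"]
        lat[of "6 * k + 2" "- 12 * k - 10"]
      by (auto simp: algebra_simps)
  qed
  then show False using packing[OF y, of 2] by simp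
qed

text \<open>\<open>packing\<close> is the coloring condition; \<open>cover\<close> holds since five
  distinct colors around \<open>z\<close> exhaust all five.\<close>

lemma color_class_grid_code:
  assumes "t > 3" "two_distance_coloring (Gt t) 5 f"
  shows "grid_code 2 t {y. f y = f x}"
proof
  fix z
  let ?N = "{z, z + 2, z - 2, z + t, z - t}"
  have range: "f v \<in> {1..5}" for v
    using assms by (simp add: two_distance_coloring_Gt_iff)
  have "card (f ` ?N) = card ?N"
    using inj_on_closed_neighborhood[OF assms] by (rule card_image)
  also have "\<dots> = 5" using assms(1) by (simp add: card_insert_if)
  finally have "f ` ?N = {1..5}"
    using range by (intro card_subset_eq) auto
  then have "f x \<in> f ` ?N" using range by blast
  then show "\<exists>d\<in>{0, 2, -2, t, -t}. z + d \<in> {y. f y = f x}" by auto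
next
  fix y d assume y: "y \<in> {y. f y = f x}" and d: "d \<in> {2, t, 2 * 2, 2 * t, 2 + t, 2 - t}"
  have "\<bar>y + d - y\<bar> \<in> {2, 4, t - 2, t, t + 2, 2 * t}"
    using d assms(1) by auto
  then show "y + d \<notin> {y. f y = f x}"
    using two_distance_coloring_Gt_neq[OF assms(2), of "y + d" y] y assms(1) by auto
qed

lemma six_le_if_coloring:
  assumes "t > 3" "t mod 10 \<in> {3, 5, 7}" "two_distance_coloring (Gt t) k f"
  shows "6 \<le> k"
proof (rule ccontr)
  assume "\<not> 6 \<le> k"
  then have "k = 5" using five_le_if_coloring[OF assms(1,3)] by simp
  then show False
    using color_class_grid_code no_grid_code assms by blast
qed

section \<open>Explicit periodic colorings\<close>

lemma two_distance_coloring_mod: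
  fixes m t :: int
  assumes "t > 2" "m > 0"
    and "\<And>d. d \<in> {2, 4, t - 2, t, t + 2, 2 * t} \<Longrightarrow> \<not> m dvd d"
  shows "two_distance_coloring (Gt t) (nat m) (\<lambda>i. nat (i mod m) + 1)"
proof -
  have "(v + d) mod m \<noteq> v mod m" if "\<not> m dvd d" for v d
    using that by (simp add: mod_eq_dvd_iff)
  moreover have "nat (i mod m) + 1 = nat (j mod m) + 1 \<longleftrightarrow> i mod m = j mod m" for i j
    using assms(2) by (simp add: eq_nat_nat_iff)
  moreover have "nat (i mod m) < nat m" for i
    using assms(2) by simp
  ultimately show ?thesis
    using assms unfolding two_distance_coloring_Gt_iff[OF assms(1)]
    by (auto simp: Suc_le_eq)
qed

definition word56 :: "int \<Rightarrow> int \<Rightarrow> int" where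
  "word56 p i = (let r = i mod p in if r < 10 then r mod 5 else (r - 10) mod 6)"

text \<open>Letters \<open>d\<close> apart differ by \<open>d\<close> inside a block and, across a
  boundary, by \<open>d\<close> minus the length of the block being left; neither vanishes, as
  blocks have length 5 or 6.\<close>

lemma word56_neq:
  assumes "p \<ge> 10" "p mod 6 = 4" "d \<in> {1, 2, 3, 4}"
  shows "word56 p (i + d) \<noteq> word56 p i"
proof -
  define r where "r = i mod p"
  have r: "0 \<le> r" "r < p" using assms(1) by (auto simp: r_def)
  have "(i + d) mod p = (r + d) mod p" by (simp add: r_def mod_simps)
  also have "\<dots> = (if r + d < p then r + d else r + d - p)"
    using r assms mod_pos_pos_trivial[of "r + d - p" p] by auto
  finally have step: "(i + d) mod p = (if r + d < p then r + d else r + d - p)" .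
  have "p = 6 * (p div 6 - 1) + 10" using assms(2) by presburger
  then obtain q where q: "p = 6 * q + 10" by blast
  have d: "d = 1 \<or> d = 2 \<or> d = 3 \<or> d = 4" using assms(3) by simp
  consider "r + d < 10" | "r < 10" "10 \<le> r + d" "r + d < p" | "10 \<le> r" "r + d < p"
    | "r < 10" "p \<le> r + d" | "10 \<le> r" "p \<le> r + d"
    by linarith
  then have "(if r < 10 then r mod 5 else (r - 10) mod 6) \<noteq>
    (let s = if r + d < p then r + d else r + d - p in if s < 10 then s mod 5 else (s - 10) mod 6)"
  proof cases
    case 1
    have "r mod 5 \<noteq> (r + d) mod 5" using d by (auto simp: mod_eq_dvd_iff)
    moreover have "r + d < p" "r < 10" using 1 assms(1) d by auto
    ultimately show ?thesis using 1 by (simp add: Let_def)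
  next
    case 2
    then have "r mod 5 = r - 5"
      using d mod_pos_pos_trivial[of "r - 5" 5] by auto
    moreover have "(r + d - 10) mod 6 = r + d - 10"
      using 2 d by (intro mod_pos_pos_trivial) auto
    ultimately show ?thesis using 2 d by (auto simp: Let_def)
  next
    case 3
    have "(r - 10) mod 6 \<noteq> (r + d - 10) mod 6" using d by (auto simp: mod_eq_dvd_iff)
    then show ?thesis using 3 d by (auto simp: Let_def)
  next
    case 4
    \<comment> \<open>If a block of length 6 is present, \<open>d\<close> is too small to wrap
      around from the first ten positions.\<close>
    then have "p = 10" using q assms(1) d by arith
    have "r mod 5 \<noteq> (r + d - 10) mod 5" using d by (auto simp: mod_eq_dvd_iff)
    then show ?thesis using 4 r d \<open>p = 10\<close> by (auto simp: Let_def)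
  next
    case 5
    have "r - 10 = r - p + 6 + 6 * (q - 1)" by (simp add: q)
    then have "(r - 10) mod 6 = (r - p + 6) mod 6" by (simp only: mod_mult_self2)
    also have "\<dots> = r - p + 6"
      using 5 r d by (intro mod_pos_pos_trivial) auto
    finally have "(r - 10) mod 6 = r - p + 6" .
    moreover have "(r + d - p) mod 5 = r + d - p"
      using 5 r d by (intro mod_pos_pos_trivial) auto
    ultimately show ?thesis using 5 r d by (auto simp: Let_def)
  qed
  then show ?thesis
    unfolding word56_def step r_def[symmetric] by (simp add: Let_def)
qed

lemma two_distance_coloring_word56:
  assumes "t \<ge> 9" "t mod 6 = 3"
  shows "two_distance_coloring (Gt t) 6 (\<lambda>i. nat (word56 (t + 1) i) + 1)"
proof -
  let ?w = "word56 (t + 1)"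
  have neq: "?w (i + d) \<noteq> ?w i" if "d \<in> {1, 2, 3, 4}" for i d
    using assms that by (intro word56_neq) (auto simp: mod_add_eq[symmetric])
  have period: "?w (i + (t + 1)) = ?w i" for i
    by (simp add: word56_def)
  \<comment> \<open>Modulo \<open>t + 1\<close> the last four differences are -3, -1, 1 and -2; for
    the negative ones \<open>neq\<close> is applied at the shifted point.\<close>
  have "?w (i + d) \<noteq> ?w i" if "d \<in> {2, 4, t - 2, t, t + 2, 2 * t}" for i d
    using that neq[of 2 i] neq[of 4 i] neq[of 3 "i + (t - 2)"] neq[of 1 "i + t"]
      neq[of 1 "i + (t + 1)"] neq[of 2 "i + 2 * t"] period[of i] period[of "i + (t + 1)"]
    by (auto simp: algebra_simps)
  moreover have "0 \<le> ?w i" "?w i < 6" for i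
    by (auto simp: word56_def Let_def intro: order.strict_trans[OF pos_mod_bound])
  ultimately show ?thesis
    using assms by (auto simp: two_distance_coloring_Gt_iff Suc_le_eq nat_less_iff eq_nat_nat_iff)
qed

lemma ex_six_coloring:
  assumes "t > 3" "odd t" "t mod 10 \<in> {3, 5, 7}"
  shows "\<exists>f. two_distance_coloring (Gt t) 6 f"
proof (cases "3 dvd t")
  case True
  then have "t mod 6 = 3" using assms(2) by presburger
  moreover have "t \<ge> 9" using assms True by presburger
  ultimately show ?thesis using two_distance_coloring_word56 by blast
next
  case False
  \<comment> \<open>\<open>2\<close>, \<open>4\<close> and \<open>2 * t\<close> are not divisible by
    3, and the other three are odd.\<close>
  then have "\<not> 6 dvd d" if "d \<in> {2, 4, t - 2, t, t + 2, 2 * t}" for d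
    using that assms(2) by (elim insertE emptyE; clarify; presburger)
  then show ?thesis
    using two_distance_coloring_mod[of t 6] assms(1) by auto
qed

text \<open>Here \<open>t\<close> is 1 or -1 modulo 5, so every forbidden difference becomes one of
  1, 2, 3, 4.\<close>

lemma five_coloring:
  fixes t :: int
  assumes "t > 3" "t mod 10 \<in> {1, 9}"
  shows "two_distance_coloring (Gt t) 5 (\<lambda>i. nat (i mod 5) + 1)"
proof -
  have "\<not> 5 dvd d" if "d \<in> {2, 4, t - 2, t, t + 2, 2 * t}" for d
    using that assms(2) by (elim insertE emptyE; clarify; presburger)
  then show ?thesis
    using two_distance_coloring_mod[of t 5] assms(1) by auto
qed

section \<open>The case \<open>t = 3\<close> and the conclusion\<close>

text \<open>For \<open>t = 3\<close> the forbidden differences are exactly 1 to 6, so seven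
  consecutive integers need distinct colors.\<close>

lemma chi2_Gt_3: "chi2 (Gt 3) = 7"
proof -
  have "two_distance_coloring (Gt 3) 7 (\<lambda>i. nat (i mod 7) + 1)"
  proof -
    have "\<not> 7 dvd d" if "d \<in> {2, 4, 3 - 2, 3, 3 + 2, 2 * 3}" for d :: int
      using that by (elim insertE emptyE) simp_all
    then show ?thesis using two_distance_coloring_mod[of 3 7] by simp
  qed
  moreover have "7 \<le> k" if col: "two_distance_coloring (Gt 3) k f" for k f
  proof -
    have "inj_on f {0..6}"
    proof (rule linorder_inj_onI)
      fix i j :: int assume "i < j" "i \<in> {0..6}" "j \<in> {0..6}"
      then have "\<bar>i - j\<bar> \<in> {2, 4, 3 - 2, 3, 3 + 2, 2 * 3}" by auto
      then show "f i \<noteq> f j" using two_distance_coloring_Gt_neq[OF col] by simp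
    qed auto
    moreover have "f ` {0..6} \<subseteq> {1..k}"
      using col by (auto simp: two_distance_coloring_Gt_iff)
    ultimately show ?thesis using card_inj_on_le[of f "{0..6}" "{1..k}"] by simp
  qed
  ultimately show ?thesis
    using chi2_eqI[of "Gt 3" 7] by (auto simp: numeral_eq_enat)
qed

theorem theorem9:
  shows "(\<forall>t::int. odd t \<and> t > 3 \<longrightarrow>
            ([t = 1] (mod 10) \<or> [t = 9] (mod 10) \<longrightarrow> chi2 (Gt t) = 5) \<and>
            ([t = 3] (mod 10) \<or> [t = 5] (mod 10) \<or> [t = 7] (mod 10) \<longrightarrow> chi2 (Gt t) = 6))
         \<and> chi2 (Gt 3) = 7"
proof (intro conjI allI impI)
  fix t :: int assume t: "odd t \<and> t > 3"
  show "chi2 (Gt t) = 5" if "[t = 1] (mod 10) \<or> [t = 9] (mod 10)"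
    using chi2_eqI[OF five_coloring five_le_if_coloring] t that
    by (auto simp: cong_def numeral_eq_enat)
  show "chi2 (Gt t) = 6" if "[t = 3] (mod 10) \<or> [t = 5] (mod 10) \<or> [t = 7] (mod 10)"
  proof -
    have m: "t mod 10 \<in> {3, 5, 7}" using that by (auto simp: cong_def)
    obtain f where "two_distance_coloring (Gt t) 6 f" using ex_six_coloring t m by blast
    then have "chi2 (Gt t) = enat 6"
      using six_le_if_coloring t m by (intro chi2_eqI) auto
    then show ?thesis by (simp add: numeral_eq_enat)
  qed
qed (fact chi2_Gt_3)

end
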